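(* There are infinitely many palindromic polynomials $f\in\mathbb{Z}[x]$ of degree $8$ that satisfy both of the following properties: (i) $f$ has at least four distinct dominant roots; and (ii) no quotient of two distinct roots of $f$ is a root of unity.
   Context: Roots are taken in $\mathbb{C}$. A root of a polynomial $f$ is dominant if it has maximal modulus among all roots of $f$. A monic polynomial $f(x)=x^d+a_{d-1}x^{d-1}+\cdots+a_1x+1\in\mathbb{Z}[x]$ is palindromic if, with $a_0=a_d=1$, one has $a_k=a_{d-k}$ for each $k\in\{0,1,\ldots,d\}$. *)

theory Defs
  imports Complex_Main "HOL-Computational_Algebra.Polynomial"
begin

definition palindromic :: "int poly \<Rightarrow> bool" where
  "palindromic f \<longleftrightarrow>
     lead_coeff f = 1 \<and> coeff f 0 = 1 \<and>
     (\<forall>k \<le> degree f. coeff f k = coeff f (degree f - k))"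

definition complex_roots :: "int poly \<Rightarrow> complex set" where
  "complex_roots f = {z. poly (map_poly of_int f) z = 0}"

definition dominant_roots :: "int poly \<Rightarrow> complex set" where
  "dominant_roots f = {z \<in> complex_roots f. \<forall>w \<in> complex_roots f. cmod w \<le> cmod z}"

definition root_of_unity :: "complex \<Rightarrow> bool" where
  "root_of_unity u \<longleftrightarrow> (\<exists>n>0. u ^ n = 1)"

end

theory Submission
  imports Defs
begin

text \<open>
  Take \<open>h = x\<^sup>4 + n x\<^sup>2 + x + 1\<close> with an integer \<open>n \<ge> 2\<close>, and let \<open>f\<close> be the product of \<open>h\<close> and
  its reversal, whose roots are the inverses of the roots of \<open>h\<close>; such a product is palindromic.
  Since \<open>h\<close> is positive on the real line, its roots are two conjugate pairs \<open>a, cnj a, c, cnj c\<close>.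
  Their product is 1, so \<open>\<bar>a\<bar> \<bar>c\<bar> = 1\<close>. The two moduli differ because the linear coefficient of
  \<open>h\<close> is nonzero. So one pair, say that of \<open>a\<close>, lies outside the unit circle, and then
  \<open>a\<close>, \<open>cnj a\<close>, \<open>1/c\<close>, \<open>1/cnj c\<close> are four roots of \<open>f\<close> of the same modulus, the maximal one.

  By comparing moduli, a quotient of distinct roots of \<open>f\<close> that is a root of unity must be, up to
  inversion and conjugation, one of \<open>a/cnj a\<close>, \<open>c/cnj c\<close>, \<open>a c\<close>, \<open>a cnj c\<close>. In terms of Galois
  theory these are excluded because the Galois group of \<open>h\<close> is large: it is transitive on the
  two-element subsets of the roots, hence carries \<open>a c\<close> to \<open>a cnj a\<close>, and it contains elements
  that carry \<open>a/cnj a\<close> to \<open>a/c\<close>, and neither image has modulus 1. The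
  proof below replaces automorphisms by linear algebra over the integers. For a pair of roots
  with sum \<open>s\<close>, the number \<open>T = s\<^sup>2\<close> is a root of the resolvent cubic
  \<open>T ((T + n)\<^sup>2 - 4) = 1\<close>. This cubic has no rational root, so \<open>1, T, T\<^sup>2\<close> are linearly
  independent over the integers whichever (real) root \<open>T\<close> is chosen
  (\<open>resolvent_linear_independence\<close>). An integer relation that holds at one root therefore holds
  at all of them.

  For \<open>a c\<close>: both \<open>x = a c\<close> and \<open>x = P\<close>, where \<open>P = a cnj a > 1\<close>, satisfy
  \<open>x + 1/x = T + n\<close>, with two different roots \<open>T\<close>, and \<open>x\<^sup>m + 1/x\<^sup>m\<close> is an integer combination of \<open>1, T, T\<^sup>2\<close> with
  coefficients that do not depend on the choice of \<open>T\<close>. So \<open>(a c)\<^sup>m = 1\<close> would force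
  \<open>P\<^sup>m + 1/P\<^sup>m = 2\<close>, which is false
  (\<open>resolvent_conjugate_power_neq_1\<close>). For \<open>a/cnj a\<close>: reducing \<open>x\<^sup>m\<close> modulo \<open>h\<close> turns
  \<open>a\<^sup>m = (cnj a)\<^sup>m\<close> into a cubic relation for \<open>a + cnj a\<close>, which can only hold if \<open>x\<^sup>m\<close> is
  congruent to a constant, so that all four roots of \<open>h\<close> have the same modulus; this is false too
  (\<open>conjugate_roots_power_neq\<close>).
\<close>

section \<open>The resolvent cubic\<close>

text \<open>
  A nontrivial relation of degree 1 makes \<open>T\<close> rational. Given one of degree 2, divide the cubic by
  it: either the remainder is a nontrivial relation of degree 1, or the division is exact and the
  linear quotient yields a rational root. A rational root of a monic integer cubic is an integer.
\<close>

lemma cubic_root_linear_independence: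
  fixes T :: real and u v w a b c :: int
  assumes root: "T^3 + of_int u * T^2 + of_int v * T + of_int w = 0"
    and noroot: "\<And>k::int. k^3 + u * k^2 + v * k + w \<noteq> 0"
    and rel: "of_int a + of_int b * T + of_int c * T^2 = 0"
  shows "a = 0 \<and> b = 0 \<and> c = 0"
proof -
  have norat: "r \<notin> \<rat>" if "r^3 + of_int u * r^2 + of_int v * r + of_int w = 0" for r :: real
  proof
    assume "r \<in> \<rat>"
    moreover have "algebraic_int r"
    proof (rule algebraic_int.intros)
      show "lead_coeff [:of_int w, of_int v, of_int u, 1 :: real:] = 1" by simp
      show "\<forall>i. coeff [:of_int w, of_int v, of_int u, 1 :: real:] i \<in> \<int>"
        by (auto simp: coeff_pCons split: nat.splits)
      show "poly [:of_int w, of_int v, of_int u, 1 :: real:] r = 0"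
        using that by (simp add: algebra_simps power2_eq_square power3_eq_cube)
    qed
    ultimately have "r \<in> \<int>" by (simp add: rational_algebraic_int_is_int)
    then obtain k :: int where "r = of_int k" by (auto elim: Ints_cases)
    with that have "real_of_int (k^3 + u * k^2 + v * k + w) = 0" by simp
    with noroot show False by (simp only: of_int_eq_0_iff)
  qed
  have irr: "x = 0" if "x \<in> \<rat>" "y \<in> \<rat>" "x * T + y = 0" for x y
  proof (rule ccontr)
    assume "x \<noteq> 0"
    then have "T = - y / x" using that(3) by (simp add: field_simps)
    then show False using norat[OF root] that by auto
  qed
  have "c = 0"
  proof (rule ccontr)
    assume c: "c \<noteq> 0"
    \<comment> \<open>The relation divided by \<open>c\<close> is \<open>x\<^sup>2 + B x + A\<close>; the quotient of the cubic by it is \<open>x - r\<close>.\<close>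
    define B A r where "B = real_of_int b / of_int c" and "A = real_of_int a / of_int c"
      and "r = B - of_int u"
    have rats: "A \<in> \<rat>" "B \<in> \<rat>" "r \<in> \<rat>" by (auto simp: A_def B_def r_def)
    have T2: "T^2 = - B * T - A"
      using rel c by (simp add: A_def B_def field_simps)
    have T3: "T^3 = (B^2 - A) * T + A * B"
    proof -
      have "T^3 = T * T^2" by (simp add: power3_eq_cube power2_eq_square)
      also have "\<dots> = - B * T^2 - A * T" by (subst T2) (simp add: algebra_simps power2_eq_square)
      also have "\<dots> = (B^2 - A) * T + A * B"
        by (subst T2) (simp add: algebra_simps power2_eq_square)
      finally show ?thesis .
    qed
    have lin: "(B * r - A + of_int v) * T + (A * r + of_int w) = 0"
      using root unfolding T3 T2 r_def by (simp add: algebra_simps power2_eq_square)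
    have 1: "B * r - A + of_int v = 0"
      by (rule irr[OF _ _ lin]) (use rats in auto)
    with lin have 2: "A * r + of_int w = 0" by simp
    have "r^3 + of_int u * r^2 + of_int v * r + of_int w
          = r * (B * r - A + of_int v) + (A * r + of_int w)"
      unfolding r_def by (simp add: algebra_simps power2_eq_square power3_eq_cube)
    then show False using norat[of r] rats 1 2 by simp
  qed
  moreover from this have "b = 0" using irr[of "of_int b" "of_int a"] rel by simp
  ultimately show ?thesis using rel by simp
qed

text \<open>
  An integer root \<open>k\<close> would divide 1, and \<open>(k + n)\<^sup>2\<close> would be 5 or 3.
\<close>

lemma resolvent_linear_independence:
  fixes T :: real and n a b c :: int
  assumes "T * ((T + of_int n)^2 - 4) = 1"
    and "of_int a + of_int b * T + of_int c * T^2 = 0"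
  shows "a = 0 \<and> b = 0 \<and> c = 0"
proof (rule cubic_root_linear_independence[where T = T and u = "2 * n" and v = "n^2 - 4" and w = "-1"])
  show "T^3 + of_int (2 * n) * T^2 + of_int (n^2 - 4) * T + of_int (-1) = 0"
    using assms(1) by (simp add: algebra_simps power2_eq_square power3_eq_cube)
  show "k^3 + 2 * n * k^2 + (n^2 - 4) * k + (-1) \<noteq> 0" for k :: int
  proof
    assume "k^3 + 2 * n * k^2 + (n^2 - 4) * k + (-1) = 0"
    then have prod: "k * ((k + n)^2 - 4) = 1"
      by (simp add: algebra_simps power2_eq_square power3_eq_cube)
    then have "k = 1 \<and> (k + n)^2 - 4 = 1 \<or> k = -1 \<and> (k + n)^2 - 4 = -1"
      by (simp only: zmult_eq_1_iff)
    then have "(k + n)^2 = 5 \<or> (k + n)^2 = 3" by linarith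
    moreover have "x^2 \<noteq> 5 \<and> x^2 \<noteq> 3" for x :: int
    proof (cases "\<bar>x\<bar> \<le> 2")
      case True
      then have "x \<in> {-2, -1, 0, 1, 2}" by auto
      then show ?thesis by auto
    next
      case False
      then have "3^2 \<le> \<bar>x\<bar>^2" by (intro power_mono) auto
      then show ?thesis by auto
    qed
    ultimately show False by blast
  qed
qed (use assms(2) in simp)

text \<open>
  The numbers \<open>x\<^sup>m + 1/x\<^sup>m\<close> satisfy a Chebyshev recursion with factor \<open>x + 1/x = T + n\<close>, and powers
  of \<open>T\<close> from the third on are reduced by the cubic. The point is the order of the quantifiers: the
  coefficients serve all roots \<open>T\<close> simultaneously.
\<close>

lemma power_plus_inverse_power_reduction:
  fixes n :: int
  shows "\<exists>a b c :: int. \<forall>x T :: complex. x \<noteq> 0 \<longrightarrow> T * ((T + of_int n)^2 - 4) = 1 \<longrightarrow>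
           x + 1 / x = T + of_int n \<longrightarrow> x^m + 1 / x^m = of_int a + of_int b * T + of_int c * T^2"
    (is "?P m")
proof -
  have "?P m \<and> ?P (Suc m)"
  proof (induction m)
    case 0
    show ?case
    proof
      show "?P 0" by (rule exI[of _ 2], rule exI[of _ 0], rule exI[of _ 0]) simp
      show "?P (Suc 0)" by (rule exI[of _ n], rule exI[of _ 1], rule exI[of _ 0]) simp
    qed
  next
    case (Suc m)
    then obtain a b c a' b' c' :: int where
      IH: "\<And>x T :: complex. x \<noteq> 0 \<Longrightarrow> T * ((T + of_int n)^2 - 4) = 1 \<Longrightarrow> x + 1 / x = T + of_int n \<Longrightarrow>
             x^m + 1 / x^m = of_int a + of_int b * T + of_int c * T^2"
      and IH': "\<And>x T :: complex. x \<noteq> 0 \<Longrightarrow> T * ((T + of_int n)^2 - 4) = 1 \<Longrightarrow> x + 1 / x = T + of_int n \<Longrightarrow>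
             x^Suc m + 1 / x^Suc m = of_int a' + of_int b' * T + of_int c' * T^2"
      by blast
    have "?P (Suc (Suc m))"
    proof (rule exI[of _ "n * a' + c' - a"], rule exI[of _ "a' + n * b' - (n^2 - 4) * c' - b"],
           rule exI[of _ "b' - n * c' - c"], intro allI impI)
      fix x T :: complex
      assume x: "x \<noteq> 0" and T: "T * ((T + of_int n)^2 - 4) = 1" and xT: "x + 1 / x = T + of_int n"
      have T3: "T^3 = 1 - 2 * of_int n * T^2 - (of_int n^2 - 4) * T"
        using T by (simp add: algebra_simps power2_eq_square power3_eq_cube)
      have "x^Suc (Suc m) + 1 / x^Suc (Suc m)
            = (x + 1 / x) * (x^Suc m + 1 / x^Suc m) - (x^m + 1 / x^m)"
        using x by (simp add: field_simps)
      also have "\<dots> = (T + of_int n) * (of_int a' + of_int b' * T + of_int c' * T^2)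
                      - (of_int a + of_int b * T + of_int c * T^2)"
        by (simp only: IH[OF x T xT] IH'[OF x T xT] xT)
      also have "\<dots> = of_int c' * T^3 + (of_int n * of_int a' - of_int a)
                      + (of_int a' + of_int n * of_int b' - of_int b) * T
                      + (of_int b' + of_int n * of_int c' - of_int c) * T^2"
        by (simp add: algebra_simps power2_eq_square power3_eq_cube)
      finally show "x^Suc (Suc m) + 1 / x^Suc (Suc m) = of_int (n * a' + c' - a)
          + of_int (a' + n * b' - (n^2 - 4) * c' - b) * T + of_int (b' - n * c' - c) * T^2"
        unfolding T3 by (simp add: algebra_simps power2_eq_square)
    qed
    with Suc show ?case by blast
  qed
  then show ?thesis by blast
qed

text \<open>
  If \<open>u\<^sup>m = 1\<close> then \<open>u\<^sup>m + 1/u\<^sup>m = 2\<close>. By linear independence the reduction of this expression to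
  \<open>1, T, T\<^sup>2\<close> is the constant 2, so it also has the value 2 at the conjugate \<open>P\<close> of \<open>u\<close>. But
  \<open>y + 1/y > 2\<close> for every positive real \<open>y \<noteq> 1\<close>.
\<close>

lemma resolvent_conjugate_power_neq_1:
  fixes n :: int and u :: complex and T T' P :: real
  assumes T: "T * ((T + of_int n)^2 - 4) = 1" and u: "u \<noteq> 0" "u + 1 / u = of_real T + of_int n"
    and T': "T' * ((T' + of_int n)^2 - 4) = 1" and P: "P > 1" "P + 1 / P = T' + of_int n"
    and m: "m > 0"
  shows "u^m \<noteq> 1"
proof
  assume um: "u^m = 1"
  obtain a b c :: int where red: "\<And>x T :: complex. x \<noteq> 0 \<Longrightarrow> T * ((T + of_int n)^2 - 4) = 1 \<Longrightarrow>
      x + 1 / x = T + of_int n \<Longrightarrow> x^m + 1 / x^m = of_int a + of_int b * T + of_int c * T^2"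
    using power_plus_inverse_power_reduction[of n m] by blast
  have cplx: "complex_of_real t * ((of_real t + of_int n)^2 - 4) = 1"
    if "t * ((t + of_int n)^2 - 4) = 1" for t :: real
    using arg_cong[OF that, of complex_of_real] by simp
  have "2 = complex_of_int a + of_int b * of_real T + of_int c * of_real T^2"
    using red[OF u(1) cplx[OF T] u(2)] um by simp
  then have "of_real 2 = complex_of_real (of_int a + of_int b * T + of_int c * T^2)"
    by simp
  then have "2 = of_int a + of_int b * T + of_int c * T^2"
    unfolding of_real_eq_iff .
  then have "a - 2 = 0 \<and> b = 0 \<and> c = 0"
    by (intro resolvent_linear_independence[OF T]) simp
  moreover have "complex_of_real P + 1 / of_real P = of_real T' + of_int n"
    using arg_cong[OF P(2), of complex_of_real] by simp
  ultimately have "complex_of_real P^m + 1 / of_real P^m = 2"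
    using red[of "of_real P" "of_real T'"] cplx[OF T'] P(1) by simp
  then have "complex_of_real (P^m + 1 / P^m) = of_real 2" by simp
  then have eq: "P^m + 1 / P^m = 2" unfolding of_real_eq_iff .
  have "P^m > 1" using P(1) m by simp
  have "(P^m - 1)^2 = P^m * (P^m + 1 / P^m - 2)"
    using P(1) by (simp add: algebra_simps power2_eq_square)
  with eq have "(P^m - 1)^2 = 0" by simp
  with \<open>P^m > 1\<close> show False by simp
qed

section \<open>Quadruples of roots of the quartic\<close>

text \<open>
  A factorization instead of a set of roots, so that the relations between roots and coefficients
  are available without a separate argument that the roots are distinct.
\<close>

definition quartic_roots :: "int \<Rightarrow> complex \<Rightarrow> complex \<Rightarrow> complex \<Rightarrow> complex \<Rightarrow> bool" where
  "quartic_roots n a b c d \<longleftrightarrow>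
     (\<forall>z. z^4 + of_int n * z^2 + z + 1 = (z - a) * (z - b) * (z - c) * (z - d))"

lemma quartic_roots_permute:
  assumes "quartic_roots n a b c d"
  shows "quartic_roots n a c b d" "quartic_roots n c d a b" "quartic_roots n a b d c"
  using assms by (simp_all add: quartic_roots_def mult_ac)

lemma quartic_roots_vieta:
  assumes "quartic_roots n a b c d"
  shows "a + b + c + d = 0" "a * b + c * d + (a + b) * (c + d) = of_int n"
    "a * b * (c + d) + c * d * (a + b) = - 1" "a * b * c * d = 1"
proof -
  let ?p = "[:-a, 1:] * [:-b, 1:] * [:-c, 1:] * [:-d, 1:]"
  have "poly [:1, 1, of_int n, 0, 1:] = poly ?p"
  proof
    fix z
    show "poly [:1, 1, of_int n, 0, 1:] z = poly ?p z"
      using assms[unfolded quartic_roots_def, rule_format, of z]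
      by (simp add: algebra_simps power2_eq_square power4_eq_xxxx)
  qed
  then have eq: "[:1, 1, of_int n, 0, 1:] = ?p" by (simp only: poly_eq_poly_eq_iff)
  from arg_cong[OF eq, of "\<lambda>p. coeff p 0"] show "a * b * c * d = 1" by (simp add: mult_ac)
  from arg_cong[OF eq, of "\<lambda>p. coeff p 3"] show "a + b + c + d = 0"
    by (simp add: numeral_eq_Suc algebra_simps)
  from arg_cong[OF eq, of "\<lambda>p. coeff p 2"]
  show "a * b + c * d + (a + b) * (c + d) = of_int n"
    by (simp add: numeral_eq_Suc algebra_simps)
  from arg_cong[OF eq, of "\<lambda>p. coeff p 1"]
  show "a * b * (c + d) + c * d * (a + b) = - 1"
    by (simp add: algebra_simps) algebra
qed

text \<open>
  The sums of the two pairs are \<open>s\<close> and \<open>- s\<close>, so the coefficients \<open>n\<close> and 1 of \<open>h\<close> give the sum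
  and the difference of the products \<open>a b\<close> and \<open>c d\<close> in terms of \<open>s\<close>. As these products are inverse
  to each other, the squares of their sum and difference differ by 4, which is the cubic for \<open>s\<^sup>2\<close>.
\<close>

lemma quartic_roots_resolvent:
  assumes "quartic_roots n a b c d"
  defines "s \<equiv> a + b"
  shows "a * b + c * d = s^2 + of_int n" "s * (a * b - c * d) = 1"
    "s^2 * ((s^2 + of_int n)^2 - 4) = 1"
proof -
  note v = quartic_roots_vieta[OF assms(1)]
  have cd: "c + d = - s" using v(1) unfolding s_def by (metis add.assoc add.commute eq_neg_iff_add_eq_0)
  show 1: "a * b + c * d = s^2 + of_int n"
    using v(2) unfolding cd s_def[symmetric] by (simp add: algebra_simps power2_eq_square)
  show 2: "s * (a * b - c * d) = 1"
    using v(3) unfolding cd s_def[symmetric] by (simp add: algebra_simps)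
  have "(a * b + c * d)^2 - 4 = (a * b - c * d)^2"
    using v(4) by (simp add: algebra_simps power2_eq_square)
  then have "s^2 * ((s^2 + of_int n)^2 - 4) = (s * (a * b - c * d))^2"
    by (simp add: 1 power_mult_distrib)
  then show "s^2 * ((s^2 + of_int n)^2 - 4) = 1" by (simp add: 2)
qed

text \<open>
  This is the remainder of \<open>x\<^sup>m\<close> modulo \<open>h\<close>, with the same coefficients for all roots.
\<close>

lemma quartic_root_power_reduction:
  fixes n :: int
  shows "\<exists>c0 c1 c2 c3 :: int. \<forall>z :: complex. z^4 + of_int n * z^2 + z + 1 = 0 \<longrightarrow>
           z^m = of_int c0 + of_int c1 * z + of_int c2 * z^2 + of_int c3 * z^3"
proof (induction m)
  case 0
  show ?case by (rule exI[of _ 1], rule exI[of _ 0], rule exI[of _ 0], rule exI[of _ 0]) simp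
next
  case (Suc m)
  then obtain c0 c1 c2 c3 :: int where
    IH: "\<And>z :: complex. z^4 + of_int n * z^2 + z + 1 = 0 \<Longrightarrow>
           z^m = of_int c0 + of_int c1 * z + of_int c2 * z^2 + of_int c3 * z^3" by blast
  show ?case
  proof (rule exI[of _ "- c3"], rule exI[of _ "c0 - c3"], rule exI[of _ "c1 - n * c3"],
         rule exI[of _ c2], intro allI impI)
    fix z :: complex
    assume z: "z^4 + of_int n * z^2 + z + 1 = 0"
    then have z4: "z^4 = - of_int n * z^2 - z - 1" by algebra
    have "z^Suc m = z * (of_int c0 + of_int c1 * z + of_int c2 * z^2 + of_int c3 * z^3)"
      by (simp add: IH[OF z])
    also have "\<dots> = of_int c0 * z + of_int c1 * z^2 + of_int c2 * z^3 + of_int c3 * z^4"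
      by (simp add: algebra_simps power2_eq_square power3_eq_cube power4_eq_xxxx)
    finally show "z^Suc m = of_int (- c3) + of_int (c0 - c3) * z + of_int (c1 - n * c3) * z^2
                    + of_int c2 * z^3"
      unfolding z4 by (simp add: algebra_simps)
  qed
qed

text \<open>
  This is the homogenization \<open>y\<^sup>4 h(x/y)\<close>. Over the integers it says that \<open>h\<close> has no rational root,
  and for \<open>y = 1\<close> over the reals that \<open>h\<close> has no real root.
\<close>

lemma quartic_form_pos:
  fixes x y n :: "'a :: linordered_idom"
  assumes "n \<ge> 1" "y \<noteq> 0"
  shows "x^4 + n * x^2 * y^2 + x * y^3 + y^4 > 0"
proof -
  have "4 * (x^4 + n * x^2 * y^2 + x * y^3 + y^4)
        = 4 * x^4 + 4 * (n - 1) * (x^2 * y^2) + y^2 * ((2 * x + y)^2 + 3 * y^2)"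
    by (simp add: algebra_simps power2_eq_square power3_eq_cube power4_eq_xxxx)
  also have "\<dots> > 0"
    using assms by (intro add_nonneg_pos mult_nonneg_nonneg mult_pos_pos) auto
  finally show ?thesis by simp
qed

text \<open>
  Divide \<open>z\<^sup>m - (cnj z)\<^sup>m\<close>, reduced modulo \<open>h\<close>, by \<open>z - cnj z\<close>. What remains is symmetric in
  \<open>z\<close> and \<open>cnj z\<close>, and since \<open>z cnj z\<close> is a rational function of \<open>s = z + cnj z\<close>, it is
  an integer cubic in \<open>s\<close> with coefficients built from \<open>c1, c2, c3\<close>. Separating its odd and
  even parts and squaring gives a cubic in \<open>T = s\<^sup>2\<close>, necessarily a multiple of the resolvent cubic.
  Comparing coefficients shows that \<open>c2/c3\<close> would be a rational root of \<open>h\<close>; hence \<open>c3 = 0\<close>, and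
  then \<open>c1 = c2 = 0\<close>, so that \<open>z\<^sup>m = c0 = c\<^sup>m\<close>.
\<close>

lemma conjugate_roots_power_neq:
  fixes n :: int
  assumes n: "n \<ge> 1" and roots: "quartic_roots n z (cnj z) c d"
    and nonreal: "Im z \<noteq> 0" and cmod: "cmod z \<noteq> cmod c" and m: "m > 0"
  shows "z^m \<noteq> cnj z^m"
proof
  assume eq: "z^m = cnj z^m"
  obtain c0 c1 c2 c3 :: int where red: "\<And>z :: complex. z^4 + of_int n * z^2 + z + 1 = 0 \<Longrightarrow>
      z^m = of_int c0 + of_int c1 * z + of_int c2 * z^2 + of_int c3 * z^3"
    using quartic_root_power_reduction[of n m] by blast
  have root: "w^4 + of_int n * w^2 + w + 1 = 0" if "w \<in> {z, cnj z, c}" for w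
    using roots that by (auto simp: quartic_roots_def)
  define s k where "s = 2 * Re z" and "k = 2 * c1 - n * c3"
  let ?T = "s^2"
  have sum: "z + cnj z = of_real s" by (simp add: s_def complex_add_cnj)
  note res = quartic_roots_resolvent[OF roots, unfolded sum]
  have "complex_of_real (s^2 * ((s^2 + of_int n)^2 - 4)) = of_real 1" using res(3) by simp
  then have T: "?T * ((?T + of_int n)^2 - 4) = 1" unfolding of_real_eq_iff .

  have "(z - cnj z) * (of_int c1 + of_int c2 * (z + cnj z) + of_int c3 * ((z + cnj z)^2 - z * cnj z)) = 0"
    using eq red[OF root[of z]] red[OF root[of "cnj z"]]
    by (simp add: algebra_simps power2_eq_square power3_eq_cube)
  moreover have "z - cnj z \<noteq> 0" using nonreal by (simp add: complex_eq_iff)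
  ultimately have lin: "of_int c1 + of_int c2 * of_real s + of_int c3 * (of_real s^2 - z * cnj z) = 0"
    by (simp add: sum)
  \<comment> \<open>Multiplying \<open>lin\<close> by \<open>2 s\<close> eliminates the product \<open>z * cnj z\<close>.\<close>
  have two: "2 * of_real s * (z * cnj z) = of_real s * (of_real s^2 + of_int n) + 1"
    using res(1,2) by algebra
  have "complex_of_real (of_int c3 * s^3 + of_int (2 * c2) * s^2 + of_int k * s - of_int c3)
    = 2 * of_real s * (of_int c1 + of_int c2 * of_real s + of_int c3 * of_real s^2)
      - of_int c3 * (of_real s * (of_real s^2 + of_int n) + 1)"
    by (simp add: k_def algebra_simps power2_eq_square power3_eq_cube)
  also have "\<dots> = 2 * of_real s *
      (of_int c1 + of_int c2 * of_real s + of_int c3 * (of_real s^2 - z * cnj z))"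
    unfolding two[symmetric] by (simp add: algebra_simps)
  finally have "complex_of_real (of_int c3 * s^3 + of_int (2 * c2) * s^2 + of_int k * s - of_int c3) = 0"
    by (simp add: lin)
  then have cubic: "of_int c3 * s^3 + of_int (2 * c2) * s^2 + of_int k * s - of_int c3 = 0"
    unfolding of_real_eq_0_iff .
  then have "s * (of_int c3 * ?T + of_int k) = of_int c3 - of_int (2 * c2) * ?T"
    by (simp add: algebra_simps power2_eq_square power3_eq_cube)
  then have "(s * (of_int c3 * ?T + of_int k))^2 = (of_int c3 - of_int (2 * c2) * ?T)^2" by simp
  then have sq: "?T * (of_int c3 * ?T + of_int k)^2 = (of_int c3 - of_int (2 * c2) * ?T)^2"
    by (simp add: power_mult_distrib)
  \<comment> \<open>The constant and cubic terms of \<open>sq\<close> are \<open>c3\<^sup>2\<close> times those of the resolvent cubic, so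
     subtracting that multiple leaves a relation between \<open>T\<close> and \<open>T\<^sup>2\<close> alone.\<close>
  have "of_int 0 + of_int (k^2 + 4 * c2 * c3 - (n^2 - 4) * c3^2) * ?T
      + of_int (2 * c3 * k - 4 * c2^2 - 2 * n * c3^2) * ?T^2
    = (?T * (of_int c3 * ?T + of_int k)^2 - (of_int c3 - of_int (2 * c2) * ?T)^2)
      - (of_int c3)^2 * (?T * ((?T + of_int n)^2 - 4) - 1)"
    by (simp add: algebra_simps power2_eq_square)
  also have "\<dots> = 0" unfolding sq T by simp
  finally have "0 = (0::int) \<and> k^2 + 4 * c2 * c3 - (n^2 - 4) * c3^2 = 0 \<and>
      2 * c3 * k - 4 * c2^2 - 2 * n * c3^2 = 0"
    by (rule resolvent_linear_independence[OF T])
  then have e1: "k^2 + 4 * c2 * c3 = (n^2 - 4) * c3^2" and e2: "c3 * k = 2 * c2^2 + n * c3^2"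
    by simp_all
  have "c3 = 0"
  proof (rule ccontr)
    assume "c3 \<noteq> 0"
    have "(c3 * k)^2 + 4 * c2 * c3^3 = c3^2 * (k^2 + 4 * c2 * c3)"
      by (simp add: algebra_simps power2_eq_square power3_eq_cube)
    then have "(2 * c2^2 + n * c3^2)^2 + 4 * c2 * c3^3 = c3^2 * ((n^2 - 4) * c3^2)"
      unfolding e1 e2 .
    then have "4 * (c2^4 + n * c2^2 * c3^2 + c2 * c3^3 + c3^4) = 0"
      by (simp add: algebra_simps power2_eq_square power3_eq_cube power4_eq_xxxx)
    then show False using quartic_form_pos[OF n \<open>c3 \<noteq> 0\<close>, of c2] by simp
  qed
  with e1 e2 have "c1 = 0" "c2 = 0" by (simp_all add: k_def)
  with \<open>c3 = 0\<close> have "z^m = c^m" using red[OF root[of z]] red[OF root[of c]] by simp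
  then have "cmod z^m = cmod c^m" by (metis norm_power)
  then have "cmod z = cmod c" using m by (simp add: power_eq_iff_eq_base)
  with cmod show False by simp
qed

text \<open>
  Splitting the roots as \<open>{a, c}\<close> and \<open>{cnj a, cnj c}\<close>, or as \<open>{a, cnj a}\<close> and \<open>{c, cnj c}\<close>,
  gives two roots of the resolvent cubic. Both are real: in the first case \<open>cnj (a c)\<close> is the
  inverse of \<open>a c\<close>, so the root is \<open>2 Re (a c) - n\<close>.
\<close>

lemma nonconjugate_roots_product_power_neq_1:
  fixes n :: int
  assumes roots: "quartic_roots n a (cnj a) c (cnj c)"
    and cmod: "cmod a > 1" and m: "m > 0"
  shows "(a * c)^m \<noteq> 1"
proof (rule resolvent_conjugate_power_neq_1[OF _ _ _ _ _ _ m])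
  note v = quartic_roots_vieta[OF roots]
  note roots' = quartic_roots_permute(1)[OF roots]
  let ?T = "2 * Re (a * c) - of_int n" and ?T' = "(2 * Re a)^2" and ?P = "(cmod a)^2"
  have "(a * c) * cnj (a * c) = 1" using v(4) by (simp add: mult_ac)
  then have inv: "1 / (a * c) = cnj (a * c)" and nz: "a * c \<noteq> 0"
    by (auto simp: divide_eq_eq mult_ac)
  have sq: "(a + c)^2 = of_real ?T"
    using quartic_roots_resolvent(1)[OF roots'] complex_add_cnj[of "a * c"]
    by (simp add: algebra_simps)
  have "complex_of_real (?T * ((?T + of_int n)^2 - 4)) = of_real 1"
    using quartic_roots_resolvent(3)[OF roots', unfolded sq] by simp
  then show "?T * ((?T + of_int n)^2 - 4) = 1" unfolding of_real_eq_iff .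
  show "a * c \<noteq> 0" by (fact nz)
  show "a * c + 1 / (a * c) = of_real ?T + of_int n"
    unfolding inv complex_add_cnj by simp
  have sum: "(a + cnj a)^2 = of_real ?T'" by (simp add: complex_add_cnj)
  note res = quartic_roots_resolvent[OF roots, unfolded sum]
  have "complex_of_real (?T' * ((?T' + of_int n)^2 - 4)) = of_real 1"
    using res(3) by simp
  then show "?T' * ((?T' + of_int n)^2 - 4) = 1" unfolding of_real_eq_iff .
  show "?P > 1" using cmod by simp
  have "complex_of_real ((cmod a)^2 * (cmod c)^2) = of_real 1"
    using v(4) by (simp add: complex_norm_square mult_ac del: of_real_power)
  then have "(cmod a)^2 * (cmod c)^2 = 1" unfolding of_real_eq_iff .
  then have Pinv: "1 / ?P = (cmod c)^2" by (metis inverse_eq_divide inverse_unique)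
  have "complex_of_real (?P + (cmod c)^2) = of_real (?T' + of_int n)"
    using res(1) by (simp add: complex_norm_square mult_ac del: of_real_power)
  then show "?P + 1 / ?P = ?T' + of_int n" unfolding of_real_eq_iff Pinv .
qed

section \<open>Two conjugate pairs on opposite sides of the unit circle\<close>

text \<open>
  A positive root \<open>s\<^sup>2\<close> of the resolvent cubic exists by the intermediate value theorem, and it
  determines a factorization of \<open>h\<close> into real quadratics \<open>x\<^sup>2 - s x + P\<close> and \<open>x\<^sup>2 + s x + P'\<close>
  with \<open>P P' = 1\<close> and \<open>P > P'\<close>. Each has a pair of nonreal roots because \<open>h\<close> has no real root.
\<close>

lemma exists_conjugate_root_pairs:
  fixes n :: int
  assumes n: "n \<ge> 2"
  obtains a c where "quartic_roots n a (cnj a) c (cnj c)" "Im a \<noteq> 0" "Im c \<noteq> 0"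
    "cmod a > 1" "Re a > 0" "Re c < 0"
proof -
  let ?g = "\<lambda>s::real. s^2 * ((s^2 + of_int n)^2 - 4)"
  have "\<exists>s\<ge>0. s \<le> 1 \<and> ?g s = 1"
  proof (rule IVT')
    have "(1 + 2)^2 \<le> (1 + real_of_int n)^2" using n by (intro power_mono) auto
    then show "1 \<le> ?g 1" by simp
  qed (auto intro!: continuous_intros)
  then obtain s where s0: "s \<ge> 0" and gs: "?g s = 1" by blast
  with s0 have s: "s > 0" by (cases "s = 0") auto
  define P P' where "P = (s^2 + of_int n + 1 / s) / 2" and "P' = (s^2 + of_int n - 1 / s) / 2"
  have PP: "P + P' = s^2 + of_int n" "s * (P - P') = 1"
    using s by (simp_all add: P_def P'_def field_simps)
  have "4 * (P * P') = (2 * P) * (2 * P')" by simp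
  also have "\<dots> = (s^2 + of_int n)^2 - (1 / s)^2"
    using s unfolding P_def P'_def by (simp add: field_simps power2_eq_square)
  also have "(1 / s)^2 = (s^2 + of_int n)^2 - 4"
    using gs s by (simp add: field_simps)
  finally have P1: "P * P' = 1" by simp
  have Ppos: "P > 0" using s n by (simp add: P_def add_pos_pos)
  then have P'pos: "P' > 0" using P1 by (metis zero_less_mult_pos zero_less_one)
  have "P > P'" using PP(2) s by (metis diff_gt_0_iff_gt zero_less_mult_pos zero_less_one)
  have "P > 1"
  proof (rule ccontr)
    assume "\<not> P > 1"
    then have "P * P' < 1 * 1" using \<open>P > P'\<close> P'pos Ppos by (intro mult_le_less_imp_less) auto
    then show False using P1 by simp
  qed
  have fact: "x^4 + of_int n * x^2 + x + 1 = (x^2 - of_real s * x + of_real P) * (x^2 + of_real s * x + of_real P')"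
    for x :: "'b :: {real_algebra_1, comm_ring_1}"
  proof -
    have "(x^2 - of_real s * x + of_real P) * (x^2 + of_real s * x + of_real P')
        = x^4 + (of_real (P + P') - of_real s^2) * x^2 + of_real (s * (P - P')) * x + of_real (P * P')"
      by (simp add: algebra_simps power2_eq_square power4_eq_xxxx)
    then show ?thesis unfolding PP P1 by simp
  qed
  have pos: "(x^2 - s * x + P) * (x^2 + s * x + P') > 0" for x
    using quartic_form_pos[of "real_of_int n" 1 x] fact[of x] n by simp
  \<comment> \<open>At the vertex of either quadratic the other one is positive. As the product of the two is
     positive, the minimum of each is positive, so the discriminants are negative.\<close>
  have "(s/2)^2 + s * (s/2) + P' > 0" using s P'pos by (intro add_nonneg_pos) auto
  then have "(s/2)^2 - s * (s/2) + P > 0" using pos[of "s/2"] by (metis zero_less_mult_pos2)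
  then have D: "P - s^2 / 4 > 0" by (simp add: power2_eq_square)
  have "(-s/2)^2 - s * (-s/2) + P > 0" using s Ppos by (intro add_nonneg_pos) auto
  then have "(-s/2)^2 + s * (-s/2) + P' > 0" using pos[of "-s/2"] by (metis zero_less_mult_pos)
  then have D': "P' - s^2 / 4 > 0" by (simp add: power2_eq_square)
  define a c where "a = Complex (s / 2) (sqrt (P - s^2 / 4))"
    and "c = Complex (- s / 2) (sqrt (P' - s^2 / 4))"
  have norms: "(cmod a)^2 = P" "(cmod c)^2 = P'"
    using D D' by (simp_all add: a_def c_def cmod_power2 power_divide)
  have prods: "a * cnj a = of_real P" "c * cnj c = of_real P'"
    by (simp_all add: complex_norm_square[symmetric] norms[symmetric])
  have sums: "a + cnj a = of_real s" "c + cnj c = - of_real s"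
    by (simp_all add: a_def c_def complex_eq_iff)
  show ?thesis
  proof
    have "z^4 + of_int n * z^2 + z + 1 = (z - a) * (z - cnj a) * (z - c) * (z - cnj c)" for z
    proof -
      have "(z - a) * (z - cnj a) = z^2 - (a + cnj a) * z + a * cnj a"
        "(z - c) * (z - cnj c) = z^2 - (c + cnj c) * z + c * cnj c"
        by (simp_all add: algebra_simps power2_eq_square)
      then have "(z - a) * (z - cnj a) * ((z - c) * (z - cnj c))
          = (z^2 - of_real s * z + of_real P) * (z^2 + of_real s * z + of_real P')"
        unfolding sums prods by simp
      then show ?thesis unfolding fact by (simp only: mult.assoc)
    qed
    then show "quartic_roots n a (cnj a) c (cnj c)" by (simp add: quartic_roots_def)
    show "Im a \<noteq> 0" "Im c \<noteq> 0" "Re a > 0" "Re c < 0"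
      using D D' s by (simp_all add: a_def c_def)
    show "cmod a > 1" using \<open>P > 1\<close> norms(1) by (metis norm_ge_zero one_power2 power2_less_imp_less)
  qed
qed

section \<open>The palindromic octics\<close>

text \<open>The second factor is the reversal of the first.\<close>

definition octic :: "int \<Rightarrow> int poly" where
  "octic n = [:1, 1, n, 0, 1:] * [:1, 0, n, 1, 1:]"

lemma octic_eq: "octic n = [:1, 1, 2 * n, n + 1, n^2 + 3, n + 1, 2 * n, 1, 1:]"
  by (simp add: octic_def power2_eq_square)

lemma palindromic_octic: "palindromic (octic n)" and degree_octic: "degree (octic n) = 8"
proof -
  show deg: "degree (octic n) = 8" by (simp add: octic_eq)
  have "coeff (octic n) k = coeff (octic n) (8 - k)" if "k \<le> 8" for k
  proof -
    have "k \<in> {0, 1, 2, 3, 4, 5, 6, 7, 8}" using that by auto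
    then show ?thesis by (auto simp: octic_eq numeral_eq_Suc)
  qed
  moreover have "coeff (octic n) 8 = 1" by (simp add: octic_eq numeral_eq_Suc)
  moreover have "coeff (octic n) 0 = 1" by (simp add: octic_eq)
  ultimately show "palindromic (octic n)"
    unfolding palindromic_def deg by blast
qed

lemma inj_octic: "inj octic"
  by (rule injI) (simp add: octic_eq)

lemma complex_roots_octic:
  assumes "quartic_roots n a b c d"
  shows "complex_roots (octic n) = {a, b, c, d} \<union> inverse ` {a, b, c, d}"
proof (intro set_eqI)
  fix z :: complex
  let ?h = "\<lambda>z :: complex. z^4 + of_int n * z^2 + z + 1"
  have h0: "?h z = 0 \<longleftrightarrow> z \<in> {a, b, c, d}" for z
    using assms by (auto simp: quartic_roots_def)
  have nz: "0 \<notin> {a, b, c, d}" using h0[of 0] by simp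
  have "poly (map_poly of_int (octic n)) z
        = ?h z * (z^4 + z^3 + of_int n * z^2 + 1)"
    by (simp add: octic_eq map_poly_pCons algebra_simps power2_eq_square power3_eq_cube power4_eq_xxxx)
  moreover have "z^4 + z^3 + of_int n * z^2 + 1 = 0 \<longleftrightarrow> z \<in> inverse ` {a, b, c, d}"
  proof (cases "z = 0")
    case True
    then show ?thesis using nz by auto
  next
    case False
    then have "z^4 + z^3 + of_int n * z^2 + 1 = z^4 * ?h (inverse z)"
      by (simp add: field_simps power2_eq_square power3_eq_cube power4_eq_xxxx)
    then have "z^4 + z^3 + of_int n * z^2 + 1 = 0 \<longleftrightarrow> inverse z \<in> {a, b, c, d}"
      using False h0[of "inverse z"] by simp
    also have "\<dots> \<longleftrightarrow> z \<in> inverse ` {a, b, c, d}"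
      by (metis image_iff inverse_inverse_eq)
    finally show ?thesis .
  qed
  ultimately show "z \<in> complex_roots (octic n) \<longleftrightarrow> z \<in> {a, b, c, d} \<union> inverse ` {a, b, c, d}"
    using h0[of z] by (auto simp: complex_roots_def)
qed

text \<open>
  The roots split into the set \<open>E\<close> of the four roots outside the unit circle and their inverses. Two
  roots with equal \<open>m\<close>-th powers have equal modulus, so they lie both in \<open>E\<close> or both among the
  inverses; inverting them reduces the second case to the first. The four elements of \<open>E\<close> are
  distinct because \<open>a\<close> is in the right and \<open>c\<close> in the left half plane.
\<close>

lemma octic_properties:
  assumes n: "n \<ge> 2"
  shows "card (dominant_roots (octic n)) \<ge> 4"
    and "\<forall>z \<in> complex_roots (octic n). \<forall>w \<in> complex_roots (octic n).
           z \<noteq> w \<longrightarrow> \<not> root_of_unity (z / w)"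
proof -
  obtain a c where roots: "quartic_roots n a (cnj a) c (cnj c)" and im: "Im a \<noteq> 0" "Im c \<noteq> 0"
    and mod_a: "cmod a > 1" and re: "Re a > 0" "Re c < 0"
    using exists_conjugate_root_pairs[OF n] .
  define E where "E = {a, cnj a, inverse c, inverse (cnj c)}"
  have all_roots: "complex_roots (octic n) = E \<union> inverse ` E"
    unfolding complex_roots_octic[OF roots] E_def by auto
  have "cmod (a * cnj a * c * cnj c) = 1" using quartic_roots_vieta(4)[OF roots] by simp
  then have "(cmod a * cmod c)^2 = 1" by (simp add: norm_mult power2_eq_square mult_ac)
  then have ac: "cmod a * cmod c = 1"
    by (metis abs_of_nonneg norm_ge_zero mult_nonneg_nonneg real_sqrt_abs real_sqrt_one)
  then have nz: "a \<noteq> 0" "c \<noteq> 0" by auto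
  have inv_c: "inverse (cmod c) = cmod a" using ac by (metis inverse_unique mult.commute)
  have mod_E: "cmod e = cmod a" if "e \<in> E" for e
    using that inv_c by (auto simp: E_def norm_inverse)
  have mod_c: "cmod c < 1"
    using one_less_inverse_iff[of "cmod c"] inv_c mod_a by simp

  have "E \<subseteq> dominant_roots (octic n)"
  proof
    fix e
    assume e: "e \<in> E"
    have "cmod w \<le> cmod e" if "w \<in> E \<union> inverse ` E" for w
    proof (cases "w \<in> E")
      case False
      then have "w \<in> inverse ` E" using \<open>w \<in> E \<union> inverse ` E\<close> by blast
      then obtain e' where "e' \<in> E" "w = inverse e'" by blast
      then have "cmod w = inverse (cmod a)" using mod_E by (simp add: norm_inverse)
      also have "\<dots> \<le> cmod a" using mod_a by (metis inverse_less_1_iff less_imp_le order.trans less_trans)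
      finally show ?thesis by (simp add: mod_E[OF e])
    qed (simp add: mod_E e)
    with e show "e \<in> dominant_roots (octic n)" by (auto simp: dominant_roots_def all_roots)
  qed
  moreover have "finite (dominant_roots (octic n))"
    by (rule finite_subset[of _ "complex_roots (octic n)"])
       (auto simp: dominant_roots_def all_roots E_def)
  moreover have "card E = 4"
  proof -
    have "Re (inverse c) < 0"
      using re(2) by (simp add: divide_neg_pos sum_power2_gt_zero_iff)
    then have "a \<noteq> inverse c" "a \<noteq> inverse (cnj c)" "cnj a \<noteq> inverse c" "cnj a \<noteq> inverse (cnj c)"
      using re(1) by (auto simp: complex_eq_iff)
    moreover have "a \<noteq> cnj a" "c \<noteq> cnj c" using im by (auto simp: complex_eq_iff)
    ultimately show ?thesis by (simp add: E_def)
  qed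
  ultimately show "card (dominant_roots (octic n)) \<ge> 4" by (metis card_mono)

  have E_power: "e^m \<noteq> e'^m" if "e \<in> E" "e' \<in> E" "e \<noteq> e'" and m: "m > 0" for e e' m
  proof -
    have "cmod a \<noteq> cmod c" using mod_a mod_c by simp
    then have A: "a^m \<noteq> cnj a^m" and C: "c^m \<noteq> cnj c^m"
      using conjugate_roots_power_neq[OF _ roots im(1) _ m] n
        conjugate_roots_power_neq[OF _ quartic_roots_permute(2)[OF roots] im(2) _ m] by auto
    have "(a * c)^m \<noteq> 1" "(a * cnj c)^m \<noteq> 1"
      using nonconjugate_roots_product_power_neq_1[OF roots mod_a m]
        nonconjugate_roots_product_power_neq_1[of n a "cnj c", OF _ mod_a m]
        quartic_roots_permute(3)[OF roots] by auto
    moreover from this have "(cnj a * cnj c)^m \<noteq> 1" "(cnj a * c)^m \<noteq> 1"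
      by (metis complex_cnj_cnj complex_cnj_mult complex_cnj_one complex_cnj_power)+
    moreover have "x^m \<noteq> inverse (y^m)" if "(x * y)^m \<noteq> 1" "y \<noteq> 0" for x y :: complex
      using that by (auto simp: power_mult_distrib)
    ultimately have "a^m \<noteq> inverse (c^m)" "a^m \<noteq> inverse (cnj c^m)"
      "cnj a^m \<noteq> inverse (c^m)" "cnj a^m \<noteq> inverse (cnj c^m)"
      using nz by auto
    note neqs = this this[symmetric] A A[symmetric] C C[symmetric]
    show ?thesis
      using that(1-3) neqs by (auto simp: E_def power_inverse)
  qed

  show "\<forall>z \<in> complex_roots (octic n). \<forall>w \<in> complex_roots (octic n).
           z \<noteq> w \<longrightarrow> \<not> root_of_unity (z / w)"
  proof (intro ballI impI notI)
    fix z w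
    assume z: "z \<in> complex_roots (octic n)" and w: "w \<in> complex_roots (octic n)"
      and neq: "z \<noteq> w" and "root_of_unity (z / w)"
    then obtain m where m: "m > 0" and "(z / w)^m = 1" by (auto simp: root_of_unity_def)
    then have pow: "z^m = w^m" by (auto simp: power_divide divide_eq_1_iff)
    then have "cmod z^m = cmod w^m" by (metis norm_power)
    then have norm_eq: "cmod z = cmod w" using m by (simp add: power_eq_iff_eq_base)
    have inv_E: "cmod x < 1 \<and> inverse x \<in> E" if "x \<in> inverse ` E" for x
      using that mod_E mod_a by (auto simp: norm_inverse inverse_less_1_iff)
    show False
    proof (cases "z \<in> E")
      case True
      then have "w \<in> E" using w norm_eq mod_E[of z] mod_a inv_E[of w] by (auto simp: all_roots)
      with True show False using E_power neq m pow by blast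
    next
      case False
      then have zE: "z \<in> inverse ` E" using z by (auto simp: all_roots)
      then have "w \<in> inverse ` E" using w norm_eq mod_E[of w] mod_a inv_E[of z] by (auto simp: all_roots)
      with zE have "inverse z \<in> E" "inverse w \<in> E" using inv_E by auto
      moreover have "inverse z^m = inverse w^m" using pow by (simp add: power_inverse)
      ultimately show False using E_power[of "inverse z" "inverse w" m] neq m by auto
    qed
  qed
qed

theorem proposition17:
  shows "infinite {f :: int poly. palindromic f \<and> degree f = 8 \<and>
           card (dominant_roots f) \<ge> 4 \<and>
           (\<forall>z \<in> complex_roots f. \<forall>w \<in> complex_roots f.
              z \<noteq> w \<longrightarrow> \<not> root_of_unity (z / w))}"
proof (rule infinite_super)
  show "octic ` {2..} \<subseteq> {f :: int poly. palindromic f \<and> degree f = 8 \<and>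
           card (dominant_roots f) \<ge> 4 \<and>
           (\<forall>z \<in> complex_roots f. \<forall>w \<in> complex_roots f.
              z \<noteq> w \<longrightarrow> \<not> root_of_unity (z / w))}"
    using octic_properties palindromic_octic degree_octic by auto
  show "infinite (octic ` {2..})"
    using inj_octic infinite_Ici[of "2::int"] by (metis finite_imageD inj_on_subset subset_UNIV)
qed

end
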